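(* Let $n\ge 2$ be an integer, let $\mu_1>0$ be a real constant, and suppose $h\in C^2((0,\infty))\cap C^1([0,\infty))$ satisfies $$2r^2h(r)h_{rr}(r)=(n-1)h(r)(h(r)-1)+rh_r(r)\big(rh_r(r)-(n-1)\big),\qquad h(r)>0,\qquad \forall r>0,$$ together with $h(0)=1$ and $h_r(0)=\mu_1$. Then $$\lim_{r\to\infty}h_r(r)=\lim_{r\to\infty}h(r)=\infty$$ and $$h(r)\ge 1+\mu_1r\quad\forall r>0.$$
   Context: Functions are real-valued; $h_r$ and $h_{rr}$ denote the first and second derivatives of $h$ in $r$. $C^1([0,\infty))$ means continuously differentiable up to $r=0$, with $h_r(0)$ the one-sided derivative at $0$. *)

theory Defs
  imports "HOL-Analysis.Analysis"
begin

end

theory Submission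
  imports Defs
begin

text \<open>
  Put \<open>G = 2 r\<^sup>2 h''\<close>. The equation expresses \<open>G\<close> through \<open>h\<close> and \<open>h'\<close> alone, so \<open>G\<close> is
  differentiable for \<open>r > 0\<close> and extends continuously by \<open>0\<close> to \<open>r = 0\<close>, and
  \<open>G' = (2 m h' (h - 1) + 2 r h'\<^sup>2) / h - m G / (2 r h)\<close> with \<open>m = n - 1\<close>. While \<open>h' > 0\<close>, and hence
  \<open>h > 1\<close>, this makes \<open>G' > 0\<close> wherever \<open>G < 0\<close>, so \<open>G\<close> has no negative minimum and \<open>h\<close> is convex;
  then \<open>h' \<ge> \<mu>\<^sub>1\<close>, so \<open>h'\<close> never vanishes and the argument is global. If \<open>h'\<close> were bounded,
  the equation would give \<open>h'' \<ge> c / r\<close> for large \<open>r\<close>, so \<open>h'\<close> would grow logarithmically.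
\<close>

locale singular_ode =
  fixes m \<mu> :: real and h h' h'' :: "real \<Rightarrow> real"
  assumes m: "m > 0" and \<mu>: "\<mu> > 0"
    and h_deriv: "\<And>r. r \<ge> 0 \<Longrightarrow> (h has_real_derivative h' r) (at r within {0..})"
    and h'_cont: "continuous_on {0..} h'"
    and h'_deriv: "\<And>r. r > 0 \<Longrightarrow> (h' has_real_derivative h'' r) (at r)"
    and ode: "\<And>r. r > 0 \<Longrightarrow>
      2 * r\<^sup>2 * h r * h'' r = m * h r * (h r - 1) + r * h' r * (r * h' r - m)"
    and h_pos: "\<And>r. r > 0 \<Longrightarrow> h r > 0"
    and h_0: "h 0 = 1" and h'_0: "h' 0 = \<mu>"
begin

text \<open>Solving the equation for \<open>2 * r\<^sup>2 * h'' r\<close> leaves only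
  \<open>h\<close> and \<open>h'\<close>, so \<open>G\<close> makes sense at 0 and can be
  differentiated without a third derivative of \<open>h\<close>.\<close>

definition G :: "real \<Rightarrow> real" where
  "G r = (m * h r * (h r - 1) + r * h' r * (r * h' r - m)) / h r"

lemma h_deriv_at: "r > 0 \<Longrightarrow> (h has_real_derivative h' r) (at r)"
  using h_deriv[of r] at_within_interior[of r "{0..}"] by (simp add: interior_real_atLeast)

lemma h_cont: "continuous_on {0..} h"
  by (rule DERIV_continuous_on[where D = h']) (use h_deriv in auto)

lemma h_cont_Icc: "continuous_on {0..b} h"
  by (rule continuous_on_subset[OF h_cont]) auto

lemma h_pos': "r \<ge> 0 \<Longrightarrow> h r > 0"
  using h_pos[of r] h_0 by (cases "r = 0") auto

lemma G_eq: "r > 0 \<Longrightarrow> G r = 2 * r\<^sup>2 * h'' r"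
  using ode[of r] h_pos[of r] by (simp add: G_def field_simps)

lemma G_cont: "continuous_on {0..} G"
  unfolding G_def using h_pos' by (intro continuous_intros h_cont h'_cont) force

text \<open>Quotient rule, with \<open>h''\<close> replaced by \<open>G r / (2 * r\<^sup>2)\<close>:
  the two terms \<open>h' r * G r / h r\<close> cancel, so \<open>G\<close> enters only linearly,
  with a negative coefficient.\<close>

lemma G_deriv:
  assumes r: "r > 0"
  shows "(G has_real_derivative
    (2 * m * h' r * (h r - 1) + 2 * r * (h' r)\<^sup>2) / h r - m * G r / (2 * r * h r)) (at r)"
proof -
  note [derivative_intros] = h_deriv_at[OF r] h'_deriv[OF r]
  have pos: "h r > 0" using h_pos[OF r] .
  have h'': "h'' r = G r / (2 * r\<^sup>2)" using G_eq[OF r] r by simp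
  define N where "N = m * h r * (h r - 1) + r * h' r * (r * h' r - m)"
  have N: "N = G r * h r" using pos by (simp add: N_def G_def)
  have "((\<lambda>r. m * h r * (h r - 1) + r * h' r * (r * h' r - m)) has_real_derivative
      2 * m * h' r * (h r - 1) + 2 * r * (h' r)\<^sup>2 + r * h'' r * (2 * r * h' r - m)) (at r)"
    by (auto intro!: derivative_eq_intros simp: algebra_simps power2_eq_square)
  from DERIV_divide[OF this h_deriv_at[OF r]] pos
  have "(G has_real_derivative
      ((2 * m * h' r * (h r - 1) + 2 * r * (h' r)\<^sup>2 + r * h'' r * (2 * r * h' r - m)) * h r
        - N * h' r) / (h r * h r)) (at r)"
    by (simp add: G_def[abs_def] N_def)
  also have "((2 * m * h' r * (h r - 1) + 2 * r * (h' r)\<^sup>2 + r * h'' r * (2 * r * h' r - m)) * h r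
        - N * h' r) / (h r * h r) =
      (2 * m * h' r * (h r - 1) + 2 * r * (h' r)\<^sup>2) / h r - m * G r / (2 * r * h r)"
    unfolding N h'' using r pos by (simp add: field_simps power2_eq_square)
  finally show ?thesis .
qed

text \<open>Used with \<open>c = 0\<close> to get \<open>h \<ge> 1\<close> while \<open>h'\<close>
  is still only known to be positive, and with \<open>c = \<mu>\<close> for the final bound.\<close>

lemma h_ge_if:
  assumes "R > 0" and "\<And>r. 0 < r \<Longrightarrow> r < R \<Longrightarrow> h' r \<ge> c"
  shows "h R \<ge> 1 + c * R"
proof -
  have "h 0 - c * 0 \<le> h R - c * R"
  proof (rule DERIV_nonneg_imp_increasing_open[where f = "\<lambda>r. h r - c * r"])
    fix r assume r: "0 < r" "r < R"
    have "((\<lambda>r. h r - c * r) has_real_derivative h' r - c) (at r)"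
      by (auto intro!: derivative_eq_intros h_deriv_at r)
    then show "\<exists>y. ((\<lambda>r. h r - c * r) has_real_derivative y) (at r) \<and> y \<ge> 0"
      using assms(2)[OF r] by force
  qed (use assms in \<open>auto intro!: continuous_intros h_cont_Icc\<close>)
  then show ?thesis by (simp add: h_0)
qed

lemma G_nonneg_if:
  assumes h'_pos: "\<And>r. 0 < r \<Longrightarrow> r \<le> R \<Longrightarrow> h' r > 0" and R: "R > 0"
  shows "G R \<ge> 0"
proof (rule ccontr)
  assume neg: "\<not> G R \<ge> 0"
  have "\<exists>s\<in>{0..R}. \<forall>r\<in>{0..R}. G s \<le> G r"
    by (rule continuous_attains_inf) (use R in \<open>auto intro: continuous_on_subset[OF G_cont]\<close>)
  then obtain s where s: "0 \<le> s" "s \<le> R" and s_min: "\<And>r. 0 \<le> r \<Longrightarrow> r \<le> R \<Longrightarrow> G s \<le> G r"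
    by auto
  have Gs: "G s < 0" using s_min[of R] neg R by simp
  \<comment> \<open>\<open>G 0 = 0\<close> because \<open>h 0 = 1\<close>.\<close>
  then have "s \<noteq> 0" by (auto simp: G_def h_0)
  with s have s0: "s > 0" by simp
  have hs: "h s \<ge> 1" using h_ge_if[of s 0] h'_pos s s0 by force
  have "2 * m * h' s * (h s - 1) \<ge> 0" "2 * s * (h' s)\<^sup>2 > 0"
    using hs h'_pos[of s] s s0 m by simp_all
  moreover have "m * G s / (2 * s * h s) < 0"
    using Gs m s0 hs by (intro divide_neg_pos mult_pos_neg) auto
  moreover have "h s > 0" using hs by simp
  ultimately have "(2 * m * h' s * (h s - 1) + 2 * s * (h' s)\<^sup>2) / h s - m * G s / (2 * s * h s) > 0"
    by (smt (verit) divide_pos_pos)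
  \<comment> \<open>Only points to the left of \<open>s\<close> are compared, so a minimum at the
    endpoint \<open>s = R\<close> is covered too.\<close>
  from DERIV_pos_inc_left[OF G_deriv[OF s0] this]
  obtain d where d: "d > 0" "\<And>e. 0 < e \<Longrightarrow> e < d \<Longrightarrow> G (s - e) < G s" by blast
  have "G (s - min (d / 2) s) < G s" using d s0 by (intro d(2)) auto
  then show False using s_min[of "s - min (d / 2) s"] s s0 d(1) by (simp add: min_def split: if_splits)
qed

text \<open>Positivity is asked only on the open interval, so that \<open>b\<close> may be the first
  point where \<open>h'\<close> fails to be positive.\<close>

lemma h'_mono_if:
  assumes "0 \<le> a" "a \<le> b" and h'_pos: "\<And>r. 0 < r \<Longrightarrow> r < b \<Longrightarrow> h' r > 0"
  shows "h' a \<le> h' b"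
proof (rule DERIV_nonneg_imp_increasing_open[OF \<open>a \<le> b\<close>])
  fix r assume r: "a < r" "r < b"
  then have r0: "r > 0" using assms(1) by simp
  have "2 * r\<^sup>2 * h'' r \<ge> 0"
    using G_nonneg_if[of r] G_eq[OF r0] h'_pos r r0 by simp
  then have "h'' r \<ge> 0" using r0 by (simp add: zero_le_mult_iff)
  then show "\<exists>y. (h' has_real_derivative y) (at r) \<and> y \<ge> 0" using h'_deriv[OF r0] by blast
qed (rule continuous_on_subset[OF h'_cont], use \<open>0 \<le> a\<close> in auto)

text \<open>At a first point \<open>R\<close> with \<open>h' R \<le> 0\<close>, monotonicity up to
  \<open>R\<close> would give \<open>h' R \<ge> \<mu> > 0\<close>.\<close>

lemma h'_pos:
  assumes "r \<ge> 0"
  shows "h' r > 0"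
proof (rule ccontr)
  assume neg: "\<not> h' r > 0"
  define Z where "Z = {s \<in> {0..r}. h' s \<le> 0}"
  have cont: "continuous_on {0..r} h'" by (rule continuous_on_subset[OF h'_cont]) auto
  have "closed Z"
    unfolding Z_def by (rule continuous_on_closed_Collect_le[OF cont continuous_on_const]) simp
  then have "compact ({0..r} \<inter> Z)" by (rule compact_Int_closed[OF compact_Icc])
  moreover have "{0..r} \<inter> Z = Z" by (auto simp: Z_def)
  ultimately have "compact Z" by simp
  moreover have "Z \<noteq> {}" using neg assms by (auto simp: Z_def)
  ultimately obtain R where R: "R \<in> Z" and R_min: "\<forall>s\<in>Z. R \<le> s"
    using compact_attains_inf[of Z] by metis
  have Rr: "0 \<le> R" "R \<le> r" "h' R \<le> 0" using R by (auto simp: Z_def)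
  have pos: "h' s > 0" if "0 < s" "s < R" for s
  proof (rule ccontr)
    assume "\<not> h' s > 0"
    then have "s \<in> Z" using that Rr by (simp add: Z_def)
    then show False using R_min \<open>s < R\<close> by fastforce
  qed
  have "h' 0 \<le> h' R" by (rule h'_mono_if[OF order_refl \<open>0 \<le> R\<close> pos])
  then show False using Rr \<mu> by (simp add: h'_0)
qed

lemma h'_mono: "0 \<le> a \<Longrightarrow> a \<le> b \<Longrightarrow> h' a \<le> h' b"
  by (rule h'_mono_if) (auto intro: h'_pos)

lemma h'_ge: "r \<ge> 0 \<Longrightarrow> h' r \<ge> \<mu>"
  using h'_mono[of 0 r] by (simp add: h'_0)

lemma h_ge: "r > 0 \<Longrightarrow> h r \<ge> 1 + \<mu> * r"
  by (rule h_ge_if) (auto intro: h'_ge)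

lemma h_le:
  assumes "r > 0" and "\<And>s. s > 0 \<Longrightarrow> h' s \<le> L"
  shows "h r \<le> 1 + L * r"
proof -
  have "h r - L * r \<le> h 0 - L * 0"
  proof (rule DERIV_nonpos_imp_decreasing_open[where f = "\<lambda>r. h r - L * r"])
    fix s assume s: "0 < s" "s < r"
    have "((\<lambda>r. h r - L * r) has_real_derivative h' s - L) (at s)"
      by (auto intro!: derivative_eq_intros h_deriv_at s)
    then show "\<exists>y. ((\<lambda>r. h r - L * r) has_real_derivative y) (at s) \<and> y \<le> 0"
      using assms(2)[OF s(1)] by force
  qed (use assms in \<open>auto intro!: continuous_intros h_cont_Icc\<close>)
  then show ?thesis by (simp add: h_0)
qed

text \<open>For \<open>r \<ge> L / \<mu>\<^sup>2\<close> the quadratic growth of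
  \<open>h r * (h r - 1)\<close> dominates \<open>r * h' r\<close>, so the terms with factor
  \<open>m\<close> are nonnegative together. What remains is \<open>(r * h' r)\<^sup>2\<close>, at
  least \<open>(r * \<mu>)\<^sup>2\<close>, while \<open>h\<close> grows at most linearly.\<close>

lemma h''_ge_if_bounded:
  assumes L: "\<And>s. s > 0 \<Longrightarrow> h' s \<le> L" and r: "r \<ge> 1" "r \<ge> L / \<mu>\<^sup>2"
  shows "h'' r \<ge> \<mu>\<^sup>2 / (2 * (1 + L)) / r"
proof -
  have r0: "r > 0" using r by simp
  have L0: "L \<ge> \<mu>" using L[OF r0] h'_ge[of r] r0 by simp
  have Lr: "L \<le> \<mu>\<^sup>2 * r" using r(2) \<mu> by (simp add: field_simps)
  have "h r * (h r - 1) \<ge> (1 + \<mu> * r) * (\<mu> * r)"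
    using h_ge[OF r0] h_pos[OF r0] \<mu> r0 by (intro mult_mono) auto
  also have "(1 + \<mu> * r) * (\<mu> * r) = \<mu> * r + \<mu>\<^sup>2 * r * r"
    by (simp add: algebra_simps power2_eq_square)
  finally have "h r * (h r - 1) \<ge> L * r"
    using mult_right_mono[OF Lr, of r] r0 mult_pos_pos[OF \<mu> r0] by linarith
  moreover have "h' r * r \<le> L * r" using L[OF r0] r0 by (intro mult_right_mono) auto
  ultimately have "m * (h r * (h r - 1) - r * h' r) \<ge> 0"
    using m by (intro mult_nonneg_nonneg) (auto simp: mult.commute)
  moreover have "(r * h' r)\<^sup>2 \<ge> (r * \<mu>)\<^sup>2"
    using h'_ge[of r] r0 \<mu> by (intro power_mono mult_left_mono) auto
  ultimately have "2 * r\<^sup>2 * h r * h'' r \<ge> (r * \<mu>)\<^sup>2"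
    unfolding ode[OF r0] by (simp add: algebra_simps power2_eq_square)
  then have "r\<^sup>2 * (2 * h r * h'' r) \<ge> r\<^sup>2 * \<mu>\<^sup>2"
    by (simp add: power_mult_distrib mult_ac)
  then have *: "2 * h r * h'' r \<ge> \<mu>\<^sup>2" using r0 by simp
  have hpos: "h r > 0" using h_pos r0 by simp
  \<comment> \<open>Here \<open>r \<ge> 1\<close> absorbs the constant term of
    \<open>1 + L * r\<close>.\<close>
  have hle: "h r \<le> (1 + L) * r" using h_le[OF r0 L] r by (simp add: algebra_simps)
  have "\<mu>\<^sup>2 / (2 * (1 + L)) / r = \<mu>\<^sup>2 / (2 * ((1 + L) * r))" by simp
  also have "\<dots> \<le> \<mu>\<^sup>2 / (2 * h r)"
    using hpos hle r0 L0 \<mu> by (intro divide_left_mono mult_pos_pos) auto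
  also have "\<dots> \<le> h'' r" using * hpos by (simp add: field_simps)
  finally show ?thesis .
qed

lemma h'_unbounded: "\<exists>r>0. h' r > L"
proof (rule ccontr)
  assume "\<not> (\<exists>r>0. h' r > L)"
  then have L: "h' s \<le> L" if "s > 0" for s using that by force
  have L0: "L > 0" using L[of 1] h'_pos[of 1] by simp
  define c where "c = \<mu>\<^sup>2 / (2 * (1 + L))"
  have c: "c > 0" using L0 \<mu> by (simp add: c_def)
  define a where "a = max 1 (L / \<mu>\<^sup>2)"
  have log: "h' r \<ge> h' a - c * ln a + c * ln r" if "r \<ge> a" for r
  proof -
    \<comment> \<open>Monotonicity of \<open>h' r - c * ln r\<close> replaces integrating
      \<open>h'' r \<ge> c / r\<close> from \<open>a\<close>, the larger of the two thresholds for
      that bound.\<close>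
    have "h' a - c * ln a \<le> h' r - c * ln r"
    proof (rule DERIV_nonneg_imp_nondecreasing[OF that])
      fix s assume s: "a \<le> s" "s \<le> r"
      then have s0: "s > 0" by (simp add: a_def)
      have "((\<lambda>r. h' r - c * ln r) has_real_derivative h'' s - c / s) (at s)"
        using s0 by (auto intro!: derivative_eq_intros h'_deriv)
      moreover have "h'' s \<ge> c / s"
        unfolding c_def using s by (intro h''_ge_if_bounded L) (auto simp: a_def)
      ultimately show "\<exists>y. ((\<lambda>r. h' r - c * ln r) has_real_derivative y) (at s) \<and> y \<ge> 0"
        by force
    qed
    then show ?thesis by simp
  qed
  have "filterlim (\<lambda>r. c * ln r) at_top at_top"
    using c by (intro filterlim_tendsto_pos_mult_at_top[OF tendsto_const] ln_at_top)
  then have "eventually (\<lambda>r. c * ln r > L - (h' a - c * ln a)) at_top"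
    by (simp add: filterlim_at_top_dense)
  from eventually_happens[OF eventually_conj[OF this eventually_ge_at_top[of a]]]
  obtain r where r: "r \<ge> a" "c * ln r > L - (h' a - c * ln a)" by auto
  have "r > 0" using r(1) by (simp add: a_def)
  from log[OF r(1)] L[OF this] r(2) show False by simp
qed

text \<open>Since \<open>h'\<close> is monotone, exceeding \<open>L\<close> once means staying above
  it.\<close>

lemma h'_at_top: "filterlim h' at_top at_top"
  unfolding filterlim_at_top
proof
  fix L
  obtain r where r: "r > 0" "h' r > L" using h'_unbounded by blast
  then have "h' s \<ge> L" if "s \<ge> r" for s
    using h'_mono[of r s] that by simp
  then show "eventually (\<lambda>s. L \<le> h' s) at_top"
    unfolding eventually_at_top_linorder by blast
qed

lemma h_at_top: "filterlim h at_top at_top"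
proof (rule filterlim_at_top_mono)
  show "filterlim (\<lambda>r. 1 + \<mu> * r) at_top at_top"
    using \<mu> by (intro filterlim_tendsto_add_at_top[OF tendsto_const]
        filterlim_tendsto_pos_mult_at_top[OF tendsto_const] filterlim_ident)
  show "eventually (\<lambda>r. 1 + \<mu> * r \<le> h r) at_top"
    using eventually_gt_at_top[of 0] by eventually_elim (rule h_ge)
qed

end

theorem theorem1p9:
  fixes n :: nat and \<mu>\<^sub>1 :: real and h h\<^sub>r h\<^sub>r\<^sub>r :: "real \<Rightarrow> real"
  assumes "n \<ge> 2" and "\<mu>\<^sub>1 > 0"
    and "\<And>r. r \<ge> 0 \<Longrightarrow> (h has_real_derivative h\<^sub>r r) (at r within {0..})"
    and "continuous_on {0..} h\<^sub>r"
    and "\<And>r. r > 0 \<Longrightarrow> (h\<^sub>r has_real_derivative h\<^sub>r\<^sub>r r) (at r)"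
    and "continuous_on {0<..} h\<^sub>r\<^sub>r"
    and "\<And>r. r > 0 \<Longrightarrow>
           2 * r\<^sup>2 * h r * h\<^sub>r\<^sub>r r
             = (real n - 1) * h r * (h r - 1) + r * h\<^sub>r r * (r * h\<^sub>r r - (real n - 1))"
    and "\<And>r. r > 0 \<Longrightarrow> h r > 0"
    and "h 0 = 1" and "h\<^sub>r 0 = \<mu>\<^sub>1"
  shows "filterlim h\<^sub>r at_top at_top \<and> filterlim h at_top at_top \<and> (\<forall>r>0. h r \<ge> 1 + \<mu>\<^sub>1 * r)"
proof -
  interpret singular_ode "real n - 1" \<mu>\<^sub>1 h h\<^sub>r h\<^sub>r\<^sub>r
    using assms by unfold_locales auto
  show ?thesis using h'_at_top h_at_top h_ge by blast
qed

end
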